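(* Over all convex quadrilaterals, $\|\mathbb{A}\|$ is uniformly bounded: there exists a constant $K>0$ such that for every convex quadrilateral $\Omega$, the $8\times 10$ matrix $\mathbb{A}=[c^{ij}_{ab}]$ (rows $ij\in V\cup E$, columns $ab\in I$) associated with $\Omega$ by the quadrilateral construction described in the context satisfies $\|\mathbb{A}\|\le K$, where $\|\mathbb{A}\|:=\max_{ij}\sum_{ab}|c^{ij}_{ab}|$.
   Context: Let $\Omega$ be a convex quadrilateral with vertices $\mathbf{v}_1,\dots,\mathbf{v}_4$ ordered counter-clockwise, each interior angle strictly less than $\pi$. Index sets: $I=\{\{a,b\}: a,b\in\{1,\dots,4\}\}$ is the set of unordered, possibly non-distinct pairs; $V=\{11,22,33,44\}$, $E=\{12,23,34,14\}$, $D=\{13,24\}$, where $ab$ denotes $\{a,b\}$. Coefficients. For $ab\in V\cup E$: $c^{ij}_{ab}=1$ if $ij=ab$ and $c^{ij}_{ab}=0$ otherwise ($ij\in V\cup E$). For $ab=13$: apply a rigid motion (rotation and translation) of the plane so that $\mathbf{v}_1=(-\ell,0)$ and $\mathbf{v}_3=(\ell,0)$ with $\ell>0$, so that $\mathbf{v}_2$ is below the $x$-axis and $\mathbf{v}_4$ is above it. In these coordinates (subscripts $x,y$ denote components) set $$c^{22}_{13}=c^{44}_{13}=0,\qquad c^{12}_{13}=c^{23}_{13}=\frac{(\mathbf{v}_4)_y}{(\mathbf{v}_4)_y-(\mathbf{v}_2)_y},\qquad c^{34}_{13}=c^{14}_{13}=\frac{(\mathbf{v}_2)_y}{(\mathbf{v}_2)_y-(\mathbf{v}_4)_y},$$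 $$c^{11}_{13}=\frac{c^{12}_{13}(\mathbf{v}_2)_x+c^{34}_{13}(\mathbf{v}_4)_x}{\ell}-1,\qquad c^{33}_{13}=-\frac{c^{12}_{13}(\mathbf{v}_2)_x+c^{34}_{13}(\mathbf{v}_4)_x}{\ell}-1.$$ The coefficients $c^{ij}_{24}$ are defined by the same construction after the cyclic relabeling $1\to2\to3\to4\to1$ of the vertices (with its own rigid motion placing $\mathbf{v}_2$ and $\mathbf{v}_4$ on the $x$-axis). *)

theory Defs
  imports "HOL-Analysis.Analysis"
begin

text \<open>
  The plane is \<^typ>\<open>complex\<close>, with x- and y-components \<^const>\<open>Re\<close> and \<^const>\<open>Im\<close>. The vertices
  are given by a function \<^typ>\<open>nat \<Rightarrow> complex\<close>, of which only the values on \<^term>\<open>{1..4::nat}\<close> matter.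
  The unordered pair \<open>ab\<close> is the set \<open>{a, b}\<close>; in particular \<open>aa\<close> is the singleton \<open>{a}\<close>.
\<close>

text \<open>The cyclic relabeling \<open>1 \<rightarrow> 2 \<rightarrow> 3 \<rightarrow> 4 \<rightarrow> 1\<close> and its inverse.\<close>

definition next_vertex :: "nat \<Rightarrow> nat" where
  "next_vertex a = a mod 4 + 1"

definition prev_vertex :: "nat \<Rightarrow> nat" where
  "prev_vertex a = (a + 2) mod 4 + 1"

text \<open>
  The angle swept counter-clockwise from the side leaving vertex \<open>a\<close> to the side arriving at it;
  for a counter-clockwise labeling this is the interior angle, for a clockwise one its complement
  to \<open>2\<pi>\<close>.
\<close>

definition interior_angle :: "(nat \<Rightarrow> complex) \<Rightarrow> nat \<Rightarrow> real" where
  "interior_angle v a =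
     Arg2pi ((v (prev_vertex a) - v a) / (v (next_vertex a) - v a))"

text \<open>
  Left turns through angles in \<open>(0, \<pi>)\<close> at all four vertices have total turning strictly
  between \<open>0\<close> and \<open>4\<pi>\<close>, hence equal to \<open>2\<pi>\<close>. So the angle condition says that the closed polygon
  through \<open>v 1, v 2, v 3, v 4\<close> is the boundary of a convex region, traversed
  counter-clockwise. Degenerate angles are excluded by \<open>0 <\<close>, since \<open>Arg2pi 0 = 0\<close> and
  \<open>x / 0 = 0\<close>.
\<close>

definition convex_quadrilateral :: "complex set \<Rightarrow> (nat \<Rightarrow> complex) \<Rightarrow> bool" where
  "convex_quadrilateral \<Omega> v \<longleftrightarrow>
     inj_on v {1..4} \<and>
     \<Omega> = convex hull (v ` {1..4}) \<and>
     (\<forall>a\<in>{1..4}. 0 < interior_angle v a \<and> interior_angle v a < pi)"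

definition I_pairs :: "nat set set" where
  "I_pairs = {{a, b} | a b. a \<in> {1..4} \<and> b \<in> {1..4}}"

definition V_pairs :: "nat set set" where
  "V_pairs = {{1}, {2}, {3}, {4}}"

definition E_pairs :: "nat set set" where
  "E_pairs = {{1, 2}, {2, 3}, {3, 4}, {1, 4}}"

definition D_pairs :: "nat set set" where
  "D_pairs = {{1, 3}, {2, 4}}"

definition rigid_motion :: "(complex \<Rightarrow> complex) \<Rightarrow> bool" where
  "rigid_motion f \<longleftrightarrow> (\<exists>u t. cmod u = 1 \<and> f = (\<lambda>z. u * z + t))"

definition places_diagonal :: "(nat \<Rightarrow> complex) \<Rightarrow> (complex \<Rightarrow> complex) \<Rightarrow> bool" where
  "places_diagonal v f \<longleftrightarrow>
     rigid_motion f \<and>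
     (\<exists>l>0. f (v 1) = Complex (- l) 0 \<and> f (v 3) = Complex l 0) \<and>
     Im (f (v 2)) < 0 \<and> Im (f (v 4)) > 0"

text \<open>
  The coefficients \<open>c\<close> with lower index \<open>13\<close> and upper index \<open>ij\<close>, in coordinates \<open>w\<close> that are
  already placed; the half-length \<open>l\<close> is then \<open>Re (w 3)\<close>.
\<close>

definition placed_coeff13 :: "(nat \<Rightarrow> complex) \<Rightarrow> nat set \<Rightarrow> real" where
  "placed_coeff13 w ij =
     (let l = Re (w 3);
          c12 = Im (w 4) / (Im (w 4) - Im (w 2));
          c34 = Im (w 2) / (Im (w 2) - Im (w 4))
      in if ij = {1} then (c12 * Re (w 2) + c34 * Re (w 4)) / l - 1
         else if ij = {3} then - ((c12 * Re (w 2) + c34 * Re (w 4)) / l) - 1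
         else if ij = {1, 2} \<or> ij = {2, 3} then c12
         else if ij = {3, 4} \<or> ij = {1, 4} then c34
         else 0)"

text \<open>The placing motion is unique, see \<open>convex_quadrilateral_places_diagonal\<close> below.\<close>

definition coeff13 :: "(nat \<Rightarrow> complex) \<Rightarrow> nat set \<Rightarrow> real" where
  "coeff13 v ij = placed_coeff13 ((THE f. places_diagonal v f) \<circ> v) ij"

text \<open>
  Relabeling carries the pairs \<open>13\<close> and \<open>ij\<close> to \<open>24\<close> and \<open>next_vertex ` ij\<close>, so the upper index
  has to be pulled back.
\<close>

definition coeff24 :: "(nat \<Rightarrow> complex) \<Rightarrow> nat set \<Rightarrow> real" where
  "coeff24 v ij = coeff13 (v \<circ> next_vertex) (prev_vertex ` ij)"

text \<open>\<open>quad_matrix v ij ab\<close> is the entry in row \<open>ij\<close> and column \<open>ab\<close>.\<close>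

definition quad_matrix :: "(nat \<Rightarrow> complex) \<Rightarrow> nat set \<Rightarrow> nat set \<Rightarrow> real" where
  "quad_matrix v ij ab =
     (if ab \<in> V_pairs \<union> E_pairs then (if ij = ab then 1 else 0)
      else if ab = {1, 3} then coeff13 v ij
      else if ab = {2, 4} then coeff24 v ij
      else 0)"

definition matrix_norm :: "(nat set \<Rightarrow> nat set \<Rightarrow> real) \<Rightarrow> real" where
  "matrix_norm A = Max ((\<lambda>ij. \<Sum>ab\<in>I_pairs. \<bar>A ij ab\<bar>) ` (V_pairs \<union> E_pairs))"

lemma I_pairs_eq: "I_pairs = V_pairs \<union> E_pairs \<union> D_pairs"
proof -
  have "{1..4} = {1, 2, 3, 4::nat}" by auto
  then show ?thesis
    unfolding I_pairs_def V_pairs_def E_pairs_def D_pairs_def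
    by (intro equalityI subsetI; simp only: Un_iff insert_iff empty_iff mem_Collect_eq; elim exE conjE disjE)
      (auto simp: insert_commute)
qed

lemma card_pairs: "card (V_pairs \<union> E_pairs) = 8" "card I_pairs = 10"
  unfolding I_pairs_eq V_pairs_def E_pairs_def D_pairs_def
  by (simp_all add: card_insert_if doubleton_eq_iff)

lemma Arg2pi_lt_pi_imp_Im_pos:
  assumes "0 < Arg2pi z" "Arg2pi z < pi"
  shows "Im z > 0"
proof -
  have "z \<noteq> 0" using assms(1) by (auto simp: Arg2pi_def)
  moreover have "Im z = cmod z * sin (Arg2pi z)"
    by (subst Arg2pi_eq[of z]) (simp add: Im_exp)
  ultimately show ?thesis using assms sin_gt_zero by simp
qed

lemma interior_angle_turn:
  assumes "convex_quadrilateral \<Omega> v" "a \<in> {1..4}"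
  shows "Im ((v (prev_vertex a) - v a) * cnj (v (next_vertex a) - v a)) > 0"
proof -
  have "Im ((v (prev_vertex a) - v a) / (v (next_vertex a) - v a)) > 0"
    using assms Arg2pi_lt_pi_imp_Im_pos
    unfolding convex_quadrilateral_def interior_angle_def by blast
  then show ?thesis by (simp only: Im_complex_div_gt_0)
qed

lemma convex_quadrilateral_relabel:
  assumes "convex_quadrilateral \<Omega> v"
  shows "convex_quadrilateral \<Omega> (v \<circ> next_vertex)"
proof -
  have s: "{1..4} = {1, 2, 3, 4::nat}" by auto
  have "v 1 \<noteq> v 2" "v 1 \<noteq> v 3" "v 1 \<noteq> v 4" "v 2 \<noteq> v 3" "v 2 \<noteq> v 4" "v 3 \<noteq> v 4"
    using assms unfolding convex_quadrilateral_def inj_on_def by force+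
  then have "inj_on (v \<circ> next_vertex) {1..4}"
    unfolding s by (simp add: next_vertex_def flip: numeral_2_eq_2)
  moreover have "(v \<circ> next_vertex) ` {1..4} = v ` {1..4}"
    unfolding s by (auto simp: next_vertex_def simp flip: numeral_2_eq_2)
  moreover have "interior_angle (v \<circ> next_vertex) a = interior_angle v (next_vertex a)"
      "next_vertex a \<in> {1..4}" if "a \<in> {1..4}" for a
    using that unfolding s interior_angle_def by (auto simp: next_vertex_def prev_vertex_def simp flip: numeral_2_eq_2)
  ultimately show ?thesis
    using assms unfolding convex_quadrilateral_def by simp
qed

lemma convex_quadrilateral_places_diagonal:
  assumes "convex_quadrilateral \<Omega> v"
  shows "\<exists>!f. places_diagonal v f"
proof -
  define d where "d = v 3 - v 1"
  have "v 3 \<noteq> v 1"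
    using assms unfolding convex_quadrilateral_def inj_on_def by force
  then have d: "d \<noteq> 0" by (simp add: d_def)
  define r where "r = cmod d"
  have r: "r > 0" using d by (simp add: r_def)
  have dd: "cnj d * d = complex_of_real r * complex_of_real r"
    by (simp add: r_def mult.commute complex_norm_square[symmetric] power2_eq_square[symmetric])
  define u where "u = cnj d / complex_of_real r"
  define t where "t = - u * (v 1 + v 3) / 2"
  have ud: "u * d = complex_of_real r"
    using dd r by (simp add: u_def field_simps)
  have turn2: "Im ((v 1 - v 2) * cnj (v 3 - v 2)) > 0"
    using interior_angle_turn[OF assms, of 2] by (simp add: next_vertex_def prev_vertex_def)
  have turn4: "Im ((v 3 - v 4) * cnj (v 1 - v 4)) > 0"
    using interior_angle_turn[OF assms, of 4] by (simp add: next_vertex_def prev_vertex_def)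
  have im: "Im (u * z + t) = Im (cnj d * (z - v 1)) / r" for z
  proof -
    have "u * z + t = u * (z - v 1) - u * d / 2"
      by (simp add: t_def d_def field_simps)
    also have "\<dots> = cnj d * (z - v 1) / complex_of_real r - complex_of_real (r / 2)"
      unfolding ud by (simp add: u_def)
    finally show ?thesis by (simp add: Im_divide_of_real)
  qed
  have "places_diagonal v (\<lambda>z. u * z + t)"
    unfolding places_diagonal_def
  proof (intro conjI)
    show "rigid_motion (\<lambda>z. u * z + t)"
      unfolding rigid_motion_def using r
      by (intro exI[of _ u] exI[of _ t]) (simp add: u_def norm_divide r_def)
    have "u * v 1 + t = - (u * d) / 2" "u * v 3 + t = u * d / 2"
      by (simp_all add: t_def d_def field_simps)
    then have "u * v 1 + t = Complex (- (r / 2)) 0" "u * v 3 + t = Complex (r / 2) 0"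
      unfolding ud by (simp_all add: complex_eq_iff)
    then show "\<exists>l>0. u * v 1 + t = Complex (- l) 0 \<and> u * v 3 + t = Complex l 0"
      using r by (intro exI[of _ "r / 2"]) simp
    have "Im (cnj d * (v 2 - v 1)) < 0"
      using turn2 by (simp add: d_def algebra_simps)
    then show "Im (u * v 2 + t) < 0" unfolding im using r by (simp add: divide_neg_pos)
    have "Im (cnj d * (v 4 - v 1)) > 0"
      using turn4 by (simp add: d_def algebra_simps)
    then show "Im (u * v 4 + t) > 0" unfolding im using r by simp
  qed
  moreover have "f = (\<lambda>z. u * z + t)" if f: "places_diagonal v f" for f
  proof -
    obtain u' t' where n: "cmod u' = 1" and f': "f = (\<lambda>z. u' * z + t')"
      using f unfolding places_diagonal_def rigid_motion_def by blast
    obtain l where l: "l > 0" "u' * v 1 + t' = Complex (- l) 0" "u' * v 3 + t' = Complex l 0"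
      using f unfolding places_diagonal_def f' by blast
    have "u' * d = (u' * v 3 + t') - (u' * v 1 + t')" by (simp add: d_def algebra_simps)
    also have "\<dots> = complex_of_real (2 * l)" unfolding l by (simp add: complex_eq_iff)
    finally have e: "u' * d = complex_of_real (2 * l)" .
    then have "cmod (u' * d) = 2 * l" using l(1) by (simp only: norm_of_real)
    then have "2 * l = r" using n by (simp add: norm_mult r_def)
    then have "u' * d = u * d" using e ud by simp
    then have u': "u' = u" using d by simp
    have "(u' * v 1 + t') + (u' * v 3 + t') = 0" unfolding l by (simp add: complex_eq_iff)
    then have "2 * t' = - u * (v 1 + v 3)"
      unfolding u' by (simp add: algebra_simps eq_neg_iff_add_eq_0)
    then have "t' = t" unfolding t_def by (simp add: field_simps)
    then show ?thesis using f' u' by simp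
  qed
  ultimately show ?thesis by blast
qed

end

theory Submission
  imports Defs
begin

text \<open>
  Place the diagonal \<open>13\<close> on the x-axis, from \<open>(- l, 0)\<close> to \<open>(l, 0)\<close>. The weights \<open>c12\<close> and
  \<open>c34\<close> are nonnegative with sum \<open>1\<close>, and they are chosen so that the convex combination
  \<open>c12 * w 2 + c34 * w 4\<close> has y-component \<open>0\<close>: it is the point where the two diagonals meet.
  In a convex quadrilateral this point lies between \<open>w 1\<close> and \<open>w 3\<close>, so its x-component has
  absolute value at most \<open>l\<close>, and the remaining coefficients \<open>c11\<close> and \<open>c33\<close>, which are
  \<open>\<plusminus> x / l - 1\<close>, lie in \<open>[-2, 0]\<close>. Hence every coefficient of a diagonal is bounded by \<open>2\<close>,
  whatever the shape of the quadrilateral (\<open>abs_coeff13_le\<close>). A row of the matrix has at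
  most one entry \<open>1\<close> from the vertex and edge columns and two entries from the diagonal columns,
  so \<open>5\<close> bounds the norm.
\<close>

text \<open>
  The left turns at \<open>w 1\<close> and \<open>w 3\<close> say that the crossing point of the
  diagonals lies to the right of \<open>w 1\<close> and to the left of \<open>w 3\<close>, respectively.
\<close>

lemma abs_diagonal_crossing_less:
  fixes w :: "nat \<Rightarrow> complex"
  assumes w: "w 1 = Complex (- l) 0" "w 3 = Complex l 0"
    and below: "Im (w 2) < 0" and above: "Im (w 4) > 0"
    and turn1: "Im ((w 4 - w 1) * cnj (w 2 - w 1)) > 0"
    and turn3: "Im ((w 2 - w 3) * cnj (w 4 - w 3)) > 0"
  shows "\<bar>Im (w 4) / (Im (w 4) - Im (w 2)) * Re (w 2)
          + Im (w 2) / (Im (w 2) - Im (w 4)) * Re (w 4)\<bar> < l"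
proof -
  let ?h = "Im (w 4) - Im (w 2)"
  let ?n = "Im (w 4) * Re (w 2) - Im (w 2) * Re (w 4)"
  have h: "?h > 0" using below above by simp
  have "Im (w 2) / (Im (w 2) - Im (w 4)) = - (Im (w 2) / ?h)"
    by (metis minus_diff_eq minus_divide_right)
  then have x: "Im (w 4) / ?h * Re (w 2) + Im (w 2) / (Im (w 2) - Im (w 4)) * Re (w 4) = ?n / ?h"
    by (simp add: diff_divide_distrib)
  have "- (l * ?h) < ?n" "?n < l * ?h"
    using turn1 turn3 unfolding w by (simp_all add: algebra_simps)
  then have "- l < ?n / ?h" "?n / ?h < l"
    using h by (simp_all add: pos_less_divide_eq pos_divide_less_eq)
  then show ?thesis unfolding x by linarith
qed

lemma abs_placed_coeff13_le:
  assumes w: "w 1 = Complex (- l) 0" "w 3 = Complex l 0" and l: "l > 0"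
    and below: "Im (w 2) < 0" and above: "Im (w 4) > 0"
    and turn1: "Im ((w 4 - w 1) * cnj (w 2 - w 1)) > 0"
    and turn3: "Im ((w 2 - w 3) * cnj (w 4 - w 3)) > 0"
  shows "\<bar>placed_coeff13 w ij\<bar> \<le> 2"
proof -
  define c12 where "c12 = Im (w 4) / (Im (w 4) - Im (w 2))"
  define c34 where "c34 = Im (w 2) / (Im (w 2) - Im (w 4))"
  define x where "x = c12 * Re (w 2) + c34 * Re (w 4)"
  have "\<bar>x\<bar> < l"
    using abs_diagonal_crossing_less[OF w below above turn1 turn3]
    by (simp only: x_def c12_def c34_def)
  then have "\<bar>x / l\<bar> < 1" using l by simp
  then have "\<bar>x / l - 1\<bar> \<le> 2" "\<bar>- (x / l) - 1\<bar> \<le> 2" by linarith+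
  moreover have "0 \<le> c12" "c12 \<le> 1" "0 \<le> c34" "c34 \<le> 1"
    using below above by (simp_all add: c12_def c34_def field_simps)
  moreover have "Re (w 3) = l" using w by simp
  ultimately show ?thesis
    by (simp add: placed_coeff13_def Let_def flip: c12_def c34_def x_def)
qed

text \<open>
  The turns of a quadrilateral can be read off in the placed coordinates: a rigid motion
  multiplies both sides at a vertex by the same unit number \<open>u\<close>, and \<open>u * cnj u = 1\<close>.
\<close>

lemma rigid_motion_turn:
  assumes "rigid_motion f"
  shows "(f p - f q) * cnj (f r - f q) = (p - q) * cnj (r - q)"
proof -
  obtain u t where u: "cmod u = 1" and f: "f = (\<lambda>z. u * z + t)"
    using assms unfolding rigid_motion_def by blast
  have "u * cnj u = 1" using u by (simp add: complex_norm_square[symmetric])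
  moreover have "(f p - f q) * cnj (f r - f q) = (u * cnj u) * ((p - q) * cnj (r - q))"
    unfolding f by (simp add: algebra_simps)
  ultimately show ?thesis by simp
qed

lemma abs_coeff13_le:
  assumes "convex_quadrilateral \<Omega> v"
  shows "\<bar>coeff13 v ij\<bar> \<le> 2"
proof -
  define f where "f = (THE f. places_diagonal v f)"
  have f: "places_diagonal v f"
    unfolding f_def using convex_quadrilateral_places_diagonal[OF assms] by (rule theI')
  then obtain l where "l > 0" "f (v 1) = Complex (- l) 0" "f (v 3) = Complex l 0"
    unfolding places_diagonal_def by blast
  moreover have "Im (f (v 2)) < 0" "Im (f (v 4)) > 0"
    using f unfolding places_diagonal_def by auto
  moreover have "rigid_motion f"
    using f unfolding places_diagonal_def by blast
  note turn = rigid_motion_turn[OF this]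
  have "Im ((f (v 4) - f (v 1)) * cnj (f (v 2) - f (v 1))) > 0"
    unfolding turn using interior_angle_turn[OF assms, of 1]
    by (simp add: next_vertex_def prev_vertex_def flip: numeral_2_eq_2)
  moreover have "Im ((f (v 2) - f (v 3)) * cnj (f (v 4) - f (v 3))) > 0"
    unfolding turn using interior_angle_turn[OF assms, of 3]
    by (simp add: next_vertex_def prev_vertex_def flip: numeral_2_eq_2)
  ultimately have "\<bar>placed_coeff13 (f \<circ> v) ij\<bar> \<le> 2"
    by (intro abs_placed_coeff13_le[where l = l]) (unfold o_def)
  then show ?thesis by (simp only: coeff13_def f_def)
qed

text \<open>
  Relabeling keeps the quadrilateral convex, so the other diagonal has the same bound.
\<close>

lemma abs_coeff24_le:
  assumes "convex_quadrilateral \<Omega> v"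
  shows "\<bar>coeff24 v ij\<bar> \<le> 2"
  unfolding coeff24_def by (rule abs_coeff13_le[OF convex_quadrilateral_relabel[OF assms]])

lemma quad_matrix_row_sum_le:
  assumes "convex_quadrilateral \<Omega> v"
  shows "(\<Sum>ab\<in>I_pairs. \<bar>quad_matrix v ij ab\<bar>) \<le> 5"
proof -
  have fin: "finite (V_pairs \<union> E_pairs)" "finite D_pairs"
    by (simp_all add: V_pairs_def E_pairs_def D_pairs_def)
  have disj: "(V_pairs \<union> E_pairs) \<inter> D_pairs = {}"
    by (auto simp: V_pairs_def E_pairs_def D_pairs_def doubleton_eq_iff)
  have "(\<Sum>ab\<in>V_pairs \<union> E_pairs. \<bar>quad_matrix v ij ab\<bar>)
      = (\<Sum>ab\<in>V_pairs \<union> E_pairs. if ij = ab then 1 else 0)"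
    by (intro sum.cong refl) (simp add: quad_matrix_def)
  also have "\<dots> \<le> 1" using fin(1) by (simp add: sum.delta)
  finally have VE: "(\<Sum>ab\<in>V_pairs \<union> E_pairs. \<bar>quad_matrix v ij ab\<bar>) \<le> 1" .
  have ne: "{1, 3} \<noteq> {2, 4::nat}" by (simp add: doubleton_eq_iff)
  have "{1, 3} \<notin> V_pairs \<union> E_pairs" "{2, 4} \<notin> V_pairs \<union> E_pairs"
    using disj by (auto simp: D_pairs_def)
  then have "quad_matrix v ij {1, 3} = coeff13 v ij" "quad_matrix v ij {2, 4} = coeff24 v ij"
    using ne by (simp_all only: quad_matrix_def if_False if_True refl ne[symmetric])
  then have "(\<Sum>ab\<in>D_pairs. \<bar>quad_matrix v ij ab\<bar>) = \<bar>coeff13 v ij\<bar> + \<bar>coeff24 v ij\<bar>"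
    using ne unfolding D_pairs_def by simp
  with VE show ?thesis
    unfolding I_pairs_eq sum.union_disjoint[OF fin disj]
    using abs_coeff13_le[OF assms, of ij] abs_coeff24_le[OF assms, of ij] by linarith
qed

theorem theorem4p5:
  shows "\<exists>K>0. \<forall>\<Omega> v. convex_quadrilateral \<Omega> v \<longrightarrow> matrix_norm (quad_matrix v) \<le> K"
proof (intro exI[of _ 5] conjI allI impI)
  fix \<Omega> v assume "convex_quadrilateral \<Omega> v"
  then show "matrix_norm (quad_matrix v) \<le> 5"
    unfolding matrix_norm_def
    by (intro Max.boundedI) (auto simp: V_pairs_def E_pairs_def intro: quad_matrix_row_sum_le)
qed simp

end
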